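(* Let $T$ be a non-degenerate triangle and let $\varepsilon>0$ be smaller than any angle of $T$. Then the limit $$h(T,\varepsilon):=\lim_{n\to\infty}\frac{h(n,T,\varepsilon)}{n^3}$$ exists and is at least $\frac1{24}$. Moreover, for all $n$, $$h(T,\varepsilon)(n^3-n)\ \ge\ h(n,T,\varepsilon)\ \ge\ h(T,\varepsilon)\,n(n-1)(n-2).$$
   Context: A triangle with angles $\alpha',\beta',\gamma'$ is called $\varepsilon$-similar to a triangle $T$ with angles $\alpha,\beta,\gamma$ if, for a suitable labelling of its angles, $|\alpha-\alpha'|<\varepsilon$, $|\beta-\beta'|<\varepsilon$ and $|\gamma-\gamma'|<\varepsilon$. $h(n,T,\varepsilon)$ denotes the maximal number of triangles (3-element subsets) in a set of $n$ points in the plane that are $\varepsilon$-similar to $T$. *)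

theory Defs
  imports "HOL-Analysis.Analysis"
begin

text \<open>The interior angle at \<open>q\<close>, in \<open>[0, \<pi>]\<close>; meaningful only if \<open>p \<noteq> q\<close> and \<open>r \<noteq> q\<close>.\<close>

definition angle_at :: "real^2 \<Rightarrow> real^2 \<Rightarrow> real^2 \<Rightarrow> real" where
  "angle_at p q r = arccos (((p - q) \<bullet> (r - q)) / (norm (p - q) * norm (r - q)))"

text \<open>A triangle is a set of three distinct points of the plane. It may be degenerate, in which
  case its angles are \<open>0, 0, \<pi>\<close>.\<close>

definition is_triangle :: "(real^2) set \<Rightarrow> bool" where
  "is_triangle S \<longleftrightarrow> card S = 3"

definition triangle_angles :: "(real^2) set \<Rightarrow> real set" where
  "triangle_angles S = {angle_at p q r | p q r. S = {p, q, r}}"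

text \<open>The two enumerations \<open>S = {a', b', c'}\<close> and \<open>T = {a, b, c}\<close> are the labellings of the
  angles.\<close>

definition eps_similar :: "real \<Rightarrow> (real^2) set \<Rightarrow> (real^2) set \<Rightarrow> bool" where
  "eps_similar \<epsilon> S T \<longleftrightarrow> is_triangle S \<and> is_triangle T \<and>
     (\<exists>a' b' c' a b c. S = {a', b', c'} \<and> T = {a, b, c} \<and>
        \<bar>angle_at b a c - angle_at b' a' c'\<bar> < \<epsilon> \<and>
        \<bar>angle_at c b a - angle_at c' b' a'\<bar> < \<epsilon> \<and>
        \<bar>angle_at a c b - angle_at a' c' b'\<bar> < \<epsilon>)"

definition similar_count :: "(real^2) set \<Rightarrow> (real^2) set \<Rightarrow> real \<Rightarrow> nat" where
  "similar_count P T \<epsilon> = card {S. S \<subseteq> P \<and> eps_similar \<epsilon> S T}"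

definition h :: "nat \<Rightarrow> (real^2) set \<Rightarrow> real \<Rightarrow> nat" where
  "h n T \<epsilon> = Max {similar_count P T \<epsilon> | P. finite P \<and> card P = n}"

definition h_lim :: "(real^2) set \<Rightarrow> real \<Rightarrow> real" where
  "h_lim T \<epsilon> = lim (\<lambda>n. real (h n T \<epsilon>) / real n ^ 3)"

lemma similar_count_le:
  assumes "finite P" shows "similar_count P T \<epsilon> \<le> card P choose 3"
proof -
  have "similar_count P T \<epsilon> \<le> card {S. S \<subseteq> P \<and> card S = 3}"
    unfolding similar_count_def
    by (rule card_mono) (use assms in \<open>auto simp: eps_similar_def is_triangle_def\<close>)
  then show ?thesis
    using n_subsets[OF assms, of 3] by simp
qed

text \<open>The maximum defining \<^const>\<open>h\<close> is over a finite nonempty set, hence attained.\<close>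

lemma finite_similar_counts:
  "finite {similar_count P T \<epsilon> | P. finite P \<and> card P = n}"
  by (rule finite_subset[of _ "{..n choose 3}"]) (auto intro: similar_count_le)

lemma similar_counts_nonempty:
  "{similar_count P T \<epsilon> | P. finite P \<and> card P = n} \<noteq> {}"
proof -
  have "infinite (UNIV :: (real^2) set)"
    using finite_imp_bounded not_bounded_UNIV by blast
  then obtain P :: "(real^2) set" where "finite P" "card P = n"
    using infinite_arbitrarily_large by blast
  then show ?thesis by blast
qed

end

theory Submission
  imports Defs "HOL-Real_Asymp.Real_Asymp"
begin

text \<open>
  Write \<open>h n\<close> for the maximal count. Two inequalities between its values carry the proof.

  Deleting one point at a time from an optimal set and counting each triangle by the points that
  avoid it gives \<open>(n - 2) * h (n + 1) \<le> (n + 1) * h n\<close> (\<open>h_averaging\<close>), so the density of similar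
  triangles \<open>h n / (n * (n - 1) * (n - 2))\<close> is nonincreasing. It therefore converges to its
  infimum, which is the limit of \<open>h n / n ^ 3\<close> as well; this gives the lower bound on \<open>h n\<close>.

  Being \<open>\<epsilon>\<close>-similar to \<open>T\<close> is an open condition on the three vertices of a triangle, because
  it is given by strict inequalities between angles, and angles depend continuously on distinct
  vertices. It is also invariant under translation and scaling. If every point of an
  optimal \<open>n\<close>-set is replaced by a tiny copy of an optimal \<open>m\<close>-set, then each similar triangle of
  the \<open>n\<close>-set yields \<open>m ^ 3\<close> of them, and each of the \<open>n\<close> small copies contributes its own \<open>h m\<close>.
  Hence \<open>h (n * m) \<ge> h n * m ^ 3 + n * h m\<close> (\<open>h_blow_up\<close>). Dividing by \<open>(n * m) ^ 3\<close> and letting \<open>m\<close>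
  tend to infinity, the limit \<open>L\<close> satisfies \<open>L \<ge> h n / n ^ 3 + L / n ^ 2\<close>, which is the upper bound
  on \<open>h n\<close>. The bound \<open>L \<ge> 1 / 24\<close> is its case \<open>n = 3\<close>, because \<open>T\<close> is similar to itself.
\<close>

section \<open>Perturbing and rescaling triangles\<close>

text \<open>Off the vertex, the cosine quotient is continuous, and it stays in the domain \<open>[-1, 1]\<close> of
  the arccosine by the Cauchy-Schwarz inequality. So continuity holds even at angles \<open>0\<close> and \<open>\<pi>\<close>,
  where the arccosine is not differentiable.\<close>

lemma tendsto_angle_at:
  assumes "(f \<longlongrightarrow> p) F" "(g \<longlongrightarrow> q) F" "(k \<longlongrightarrow> r) F" and "p \<noteq> q" "r \<noteq> q"
  shows "((\<lambda>x. angle_at (f x) (g x) (k x)) \<longlongrightarrow> angle_at p q r) F"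
proof -
  define c where "c = (\<lambda>p q r :: real^2. ((p - q) \<bullet> (r - q)) / (norm (p - q) * norm (r - q)))"
  have c_range: "c p q r \<in> {-1..1}" for p q r
  proof -
    have "\<bar>(p - q) \<bullet> (r - q)\<bar> / (norm (p - q) * norm (r - q)) \<le> 1"
      by (rule divide_le_eq_1[THEN iffD2]) (use Cauchy_Schwarz_ineq2[of "p - q" "r - q"] in auto)
    then have "\<bar>c p q r\<bar> \<le> 1" by (simp add: c_def abs_mult)
    then show ?thesis by (auto simp: abs_le_iff)
  qed
  have "((\<lambda>x. c (f x) (g x) (k x)) \<longlongrightarrow> c p q r) F"
    unfolding c_def using assms by (intro tendsto_intros) auto
  from continuous_on_tendsto_compose[OF continuous_on_arccos' this] c_range
  show ?thesis by (simp add: angle_at_def c_def)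
qed

lemma angle_at_homothety:
  assumes "t > 0"
  shows "angle_at (x + t *\<^sub>R p) (x + t *\<^sub>R q) (x + t *\<^sub>R r) = angle_at p q r"
proof -
  have "x + t *\<^sub>R u - (x + t *\<^sub>R v) = t *\<^sub>R (u - v)" for u v
    by (simp add: algebra_simps)
  then show ?thesis using assms by (simp add: angle_at_def)
qed

lemma eps_similarE:
  assumes "eps_similar \<epsilon> S T"
  obtains a' b' c' a b c where "S = {a', b', c'}" "T = {a, b, c}"
    "\<bar>angle_at b a c - angle_at b' a' c'\<bar> < \<epsilon>"
    "\<bar>angle_at c b a - angle_at c' b' a'\<bar> < \<epsilon>"
    "\<bar>angle_at a c b - angle_at a' c' b'\<bar> < \<epsilon>"
    and "is_triangle S" "is_triangle T"
  using assms unfolding eps_similar_def by (elim conjE exE) (rule that)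

lemma eps_similar_homothety:
  assumes "eps_similar \<epsilon> S T" "t > 0"
  shows "eps_similar \<epsilon> ((\<lambda>p. x + t *\<^sub>R p) ` S) T"
proof -
  have "inj_on (\<lambda>p. x + t *\<^sub>R p) S"
    using assms(2) by (auto simp: inj_on_def)
  then have card: "card ((\<lambda>p. x + t *\<^sub>R p) ` S) = card S" by (rule card_image)
  from assms(1) obtain a' b' c' a b c where abc: "S = {a', b', c'}" "T = {a, b, c}"
    "\<bar>angle_at b a c - angle_at b' a' c'\<bar> < \<epsilon>"
    "\<bar>angle_at c b a - angle_at c' b' a'\<bar> < \<epsilon>"
    "\<bar>angle_at a c b - angle_at a' c' b'\<bar> < \<epsilon>"
    and "is_triangle S" "is_triangle T" by (rule eps_similarE)
  show ?thesis
    unfolding eps_similar_def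
  proof (intro conjI exI)
    show "is_triangle ((\<lambda>p. x + t *\<^sub>R p) ` S)" using card \<open>is_triangle S\<close> by (simp add: is_triangle_def)
    show "(\<lambda>p. x + t *\<^sub>R p) ` S = {x + t *\<^sub>R a', x + t *\<^sub>R b', x + t *\<^sub>R c'}" using abc(1) by simp
    show "T = {a, b, c}" by (fact abc(2))
  qed (simp_all only: angle_at_homothety[OF assms(2)] abc(3-5) \<open>is_triangle T\<close>)
qed

text \<open>Moving each vertex \<open>p\<close> by \<open>t *\<^sub>R g p\<close> changes the angles continuously in \<open>t\<close>, and their
  deviations from the angles of \<open>T\<close> are strictly below \<open>\<epsilon>\<close> at \<open>t = 0\<close>. The vertices also have to
  stay distinct, as otherwise the image is not a triangle.\<close>

lemma eventually_eps_similar_perturbation: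
  assumes "eps_similar \<epsilon> S T"
  shows "\<forall>\<^sub>F t in at_right (0::real). eps_similar \<epsilon> ((\<lambda>p. p + t *\<^sub>R g p) ` S) T"
proof -
  from assms obtain a' b' c' a b c where abc: "S = {a', b', c'}" "T = {a, b, c}"
    "\<bar>angle_at b a c - angle_at b' a' c'\<bar> < \<epsilon>"
    "\<bar>angle_at c b a - angle_at c' b' a'\<bar> < \<epsilon>"
    "\<bar>angle_at a c b - angle_at a' c' b'\<bar> < \<epsilon>"
    and tri: "is_triangle S" "is_triangle T" by (rule eps_similarE)
  have ne: "a' \<noteq> b'" "b' \<noteq> c'" "a' \<noteq> c'"
    using tri(1) abc(1) by (auto simp: is_triangle_def card_insert_if split: if_splits)
  let ?f = "\<lambda>t p. p + t *\<^sub>R g p"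
  have lim: "((\<lambda>t. ?f t p) \<longlongrightarrow> p) (at_right 0)" for p
  proof -
    have "((\<lambda>t. ?f t p) \<longlongrightarrow> p + 0 *\<^sub>R g p) (at_right 0)" by (intro tendsto_intros)
    then show ?thesis by simp
  qed
  have near: "\<forall>\<^sub>F t in at_right 0. \<bar>\<theta> - angle_at (?f t p) (?f t q) (?f t r)\<bar> < \<epsilon>"
    if "\<bar>\<theta> - angle_at p q r\<bar> < \<epsilon>" "p \<noteq> q" "r \<noteq> q" for \<theta> p q r
  proof -
    have "((\<lambda>t. \<bar>\<theta> - angle_at (?f t p) (?f t q) (?f t r)\<bar>) \<longlongrightarrow> \<bar>\<theta> - angle_at p q r\<bar>) (at_right 0)"
      by (rule tendsto_rabs[OF tendsto_diff[OF tendsto_const tendsto_angle_at[OF lim lim lim that(2,3)]]])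
    then show ?thesis using that(1) by (rule order_tendstoD(2))
  qed
  have distinct: "\<forall>\<^sub>F t in at_right 0. ?f t p \<noteq> ?f t q" if "p \<noteq> q" for p q
  proof -
    have "((\<lambda>t. ?f t p - ?f t q) \<longlongrightarrow> p - q) (at_right 0)" by (intro tendsto_diff lim)
    then have "\<forall>\<^sub>F t in at_right 0. ?f t p - ?f t q \<noteq> 0"
      by (rule tendsto_imp_eventually_ne) (use that in simp)
    then show ?thesis by simp
  qed
  show ?thesis
    using near[OF abc(3) ne(1)[symmetric] ne(3)[symmetric]]
      near[OF abc(4) ne(2)[symmetric] ne(1)] near[OF abc(5) ne(3) ne(2)]
      distinct[OF ne(1)] distinct[OF ne(2)] distinct[OF ne(3)]
  proof eventually_elim
    case (elim t)
    show ?case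
      unfolding eps_similar_def
    proof (intro conjI exI)
      show "is_triangle (?f t ` S)" using elim(4-6) by (simp add: abc(1) is_triangle_def)
      show "?f t ` S = {?f t a', ?f t b', ?f t c'}" using abc(1) by simp
      show "T = {a, b, c}" by (fact abc(2))
    qed (fact tri(2) elim)+
  qed
qed

section \<open>Inequalities between the maximal counts\<close>

lemma similar_count_le_h:
  assumes "finite P" shows "similar_count P T \<epsilon> \<le> h (card P) T \<epsilon>"
  unfolding h_def by (rule Max_ge[OF finite_similar_counts]) (use assms in blast)

lemma h_attained:
  obtains P where "finite P" "card P = n" "similar_count P T \<epsilon> = h n T \<epsilon>"
proof -
  have "h n T \<epsilon> \<in> {similar_count P T \<epsilon> | P. finite P \<and> card P = n}"
    unfolding h_def by (rule Max_in[OF finite_similar_counts similar_counts_nonempty])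
  then show ?thesis by (elim CollectE exE conjE) (rule that, simp_all)
qed

lemma h_eq_0:
  assumes "n < 3" shows "h n T \<epsilon> = 0"
proof -
  obtain P where "finite P" "card P = n" "similar_count P T \<epsilon> = h n T \<epsilon>"
    by (rule h_attained)
  with similar_count_le[of P T \<epsilon>] assms show ?thesis by (simp add: binomial_eq_0)
qed

lemma h_3_ge_1:
  assumes "is_triangle T" "\<epsilon> > 0"
  shows "h 3 T \<epsilon> \<ge> 1"
proof -
  have "card T = 3" using assms(1) by (simp add: is_triangle_def)
  then have fin: "finite T" by (intro card_ge_0_finite) simp
  from \<open>card T = 3\<close> obtain a b c where "T = {a, b, c}" unfolding card_3_iff by blast
  then have "eps_similar \<epsilon> T T"
    using assms unfolding eps_similar_def
    by (intro conjI exI[of _ a] exI[of _ b] exI[of _ c]) simp_all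
  then have "similar_count T T \<epsilon> \<noteq> 0"
    using fin by (auto simp: similar_count_def)
  with similar_count_le_h[OF fin, of T \<epsilon>] \<open>card T = 3\<close> show ?thesis by simp
qed

text \<open>Double counting of the pairs of a similar triangle \<open>S\<close> in an optimal \<open>(n + 1)\<close>-set and a
  point of that set outside \<open>S\<close>: each triangle misses \<open>n - 2\<close> points, and for each of the \<open>n + 1\<close>
  points the triangles avoiding it lie in an \<open>n\<close>-set.\<close>

lemma h_averaging: "(n - 2) * h (Suc n) T \<epsilon> \<le> Suc n * h n T \<epsilon>"
proof -
  obtain P where P: "finite P" "card P = Suc n" "similar_count P T \<epsilon> = h (Suc n) T \<epsilon>"
    by (rule h_attained)
  define F where "F = {S. S \<subseteq> P \<and> eps_similar \<epsilon> S T}"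
  have finF: "finite F" by (rule finite_subset[of _ "Pow P"]) (use P in \<open>auto simp: F_def\<close>)
  have "card {x\<in>P. x \<notin> S} = n - 2" if "S \<in> F" for S
  proof -
    from that have "S \<subseteq> P" "card S = 3" by (auto simp: F_def eps_similar_def is_triangle_def)
    then have "card (P - S) = n - 2" using P finite_subset by (subst card_Diff_subset) auto
    moreover have "{x\<in>P. x \<notin> S} = P - S" by auto
    ultimately show ?thesis by simp
  qed
  then have "(\<Sum>x\<in>P. card {S\<in>F. x \<notin> S}) = (n - 2) * card F"
    using sum_multicount[OF P(1) finF, of "\<lambda>x S. x \<notin> S" "n - 2"] by blast
  moreover have "(\<Sum>x\<in>P. card {S\<in>F. x \<notin> S}) \<le> (\<Sum>x\<in>P. h n T \<epsilon>)"
  proof (rule sum_mono)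
    fix x assume "x \<in> P"
    have "{S\<in>F. x \<notin> S} = {S. S \<subseteq> P - {x} \<and> eps_similar \<epsilon> S T}" by (auto simp: F_def)
    then have "card {S\<in>F. x \<notin> S} = similar_count (P - {x}) T \<epsilon>"
      by (simp add: similar_count_def)
    then show "card {S\<in>F. x \<notin> S} \<le> h n T \<epsilon>"
      using similar_count_le_h[of "P - {x}" T \<epsilon>] P \<open>x \<in> P\<close> by simp
  qed
  ultimately show ?thesis using P by (simp add: F_def similar_count_def)
qed

text \<open>The purely combinatorial part of the blow-up: the triples of \<open>P \<times> Q\<close> that project injectively
  onto a member of \<open>F\<close> are the graphs of functions from that member to \<open>Q\<close>, and these are distinct
  from each other and from the triples inside a single fibre.\<close>

lemma card_blow_up_triples:
  assumes "finite P" "finite Q"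
    and F: "\<And>S. S \<in> F \<Longrightarrow> S \<subseteq> P \<and> card S = 3"
    and G: "\<And>S. S \<in> G \<Longrightarrow> S \<subseteq> Q \<and> card S = 3"
    and H: "H \<subseteq> Pow (P \<times> Q)"
    and graphs: "\<And>S g. S \<in> F \<Longrightarrow> g \<in> S \<rightarrow>\<^sub>E Q \<Longrightarrow> (\<lambda>p. (p, g p)) ` S \<in> H"
    and fibres: "\<And>p S. p \<in> P \<Longrightarrow> S \<in> G \<Longrightarrow> Pair p ` S \<in> H"
  shows "card F * card Q ^ 3 + card P * card G \<le> card H"
proof -
  have finF: "finite F" by (rule finite_subset[of _ "Pow P"]) (use F assms(1) in auto)
  have finS: "finite S" if "S \<in> F" for S using F[OF that] assms(1) finite_subset by blast
  define A where "A = (SIGMA S:F. S \<rightarrow>\<^sub>E Q)"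
  define \<gamma> where "\<gamma> = (\<lambda>(S, g). (\<lambda>p. (p, g p :: 'b)) ` (S :: 'a set))"
  define \<phi> where "\<phi> = (\<lambda>(p :: 'a, S :: 'b set). Pair p ` S)"
  have "card A = (\<Sum>S\<in>F. card (S \<rightarrow>\<^sub>E Q))"
    unfolding A_def using finF finS assms(2) by (intro card_SigmaI) (auto intro: finite_PiE)
  also have "\<dots> = (\<Sum>S\<in>F. card Q ^ 3)"
    using F finS by (intro sum.cong) (auto simp: card_PiE)
  finally have cardA: "card A = card F * card Q ^ 3" by simp
  have "inj_on \<gamma> A"
  proof (rule inj_onI, clarify)
    fix S g S' g' assume mem: "(S, g) \<in> A" "(S', g') \<in> A" and eq: "\<gamma> (S, g) = \<gamma> (S', g')"
    have "fst ` \<gamma> (S, g) = S" "fst ` \<gamma> (S', g') = S'" by (auto simp: \<gamma>_def image_image)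
    with eq have "S = S'" by simp
    moreover have "g p = g' p" if "p \<in> S" for p
    proof -
      from that have "(p, g p) \<in> \<gamma> (S, g)" by (auto simp: \<gamma>_def)
      with eq show ?thesis by (auto simp: \<gamma>_def)
    qed
    ultimately show "S = S' \<and> g = g'"
      using mem by (auto simp: A_def intro: PiE_ext)
  qed
  then have 1: "card (\<gamma> ` A) = card F * card Q ^ 3" by (simp add: card_image cardA)
  have "inj_on \<phi> (P \<times> G)"
  proof (rule inj_onI, clarify)
    fix p S p' S' assume "S \<in> G" and eq: "\<phi> (p, S) = \<phi> (p', S')"
    from G[OF \<open>S \<in> G\<close>] obtain s where "s \<in> S" by fastforce
    then have "(p, s) \<in> \<phi> (p, S)" by (auto simp: \<phi>_def)
    with eq have "p = p'" by (auto simp: \<phi>_def)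
    moreover have "snd ` \<phi> (p, S) = S" "snd ` \<phi> (p', S') = S'" by (auto simp: \<phi>_def image_image)
    then have "S = S'" unfolding eq by (rule trans[OF sym])
    ultimately show "p = p' \<and> S = S'" by blast
  qed
  then have 2: "card (\<phi> ` (P \<times> G)) = card P * card G" by (simp add: card_image card_cartesian_product)
  \<comment> \<open>Graphs have a three-element first projection, triples in a fibre a one-element one.\<close>
  have "card (fst ` X) = 3" if "X \<in> \<gamma> ` A" for X
    using that F by (auto simp: \<gamma>_def A_def image_image)
  moreover have "card (fst ` X) \<le> 1" if "X \<in> \<phi> ` (P \<times> G)" for X
  proof -
    from that obtain p S where "X = Pair p ` S" by (auto simp: \<phi>_def)
    then have "fst ` X \<subseteq> {p}" by auto
    then have "card (fst ` X) \<le> card {p}" by (rule card_mono[rotated]) simp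
    then show ?thesis by simp
  qed
  ultimately have disj: "\<gamma> ` A \<inter> \<phi> ` (P \<times> G) = {}" by fastforce
  have "\<gamma> ` A \<union> \<phi> ` (P \<times> G) \<subseteq> H"
    using graphs fibres by (auto simp: \<gamma>_def \<phi>_def A_def)
  moreover have finH: "finite H" using H assms(1,2) by (auto intro: finite_subset)
  ultimately have "card (\<gamma> ` A \<union> \<phi> ` (P \<times> G)) \<le> card H" by (intro card_mono)
  moreover have "finite (\<gamma> ` A)" "finite (\<phi> ` (P \<times> G))"
    using \<open>\<gamma> ` A \<union> \<phi> ` (P \<times> G) \<subseteq> H\<close> finH by (auto intro: finite_subset)
  ultimately show ?thesis using 1 2 disj by (simp add: card_Un_disjoint)
qed

text \<open>Replacing each point \<open>p\<close> of \<open>P\<close> by the copy \<open>p + t Q\<close> of \<open>Q\<close> works for all small positive \<open>t\<close>: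
  only finitely many requirements have to be met, and each of them holds for small \<open>t\<close>.\<close>

lemma h_blow_up: "h n T \<epsilon> * m ^ 3 + n * h m T \<epsilon> \<le> h (n * m) T \<epsilon>"
proof -
  obtain P where P: "finite P" "card P = n" "similar_count P T \<epsilon> = h n T \<epsilon>" by (rule h_attained)
  obtain Q where Q: "finite Q" "card Q = m" "similar_count Q T \<epsilon> = h m T \<epsilon>" by (rule h_attained)
  define F where "F = {S. S \<subseteq> P \<and> eps_similar \<epsilon> S T}"
  define G where "G = {S. S \<subseteq> Q \<and> eps_similar \<epsilon> S T}"
  define f where "f = (\<lambda>t (p, q). p + t *\<^sub>R q :: real^2)"
  have finF: "finite F" by (rule finite_subset[of _ "Pow P"]) (use P in \<open>auto simp: F_def\<close>)
  have finS: "finite S" if "S \<in> F" for S using that P finite_subset by (auto simp: F_def)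
  have "\<forall>\<^sub>F t in at_right 0. \<forall>S\<in>F. \<forall>g\<in>S \<rightarrow>\<^sub>E Q. eps_similar \<epsilon> ((\<lambda>p. p + t *\<^sub>R g p) ` S) T"
    using finF finS Q
    by (intro eventually_ball_finite ballI eventually_eps_similar_perturbation)
       (auto simp: F_def intro!: finite_PiE)
  moreover have "\<forall>\<^sub>F t in at_right 0. \<forall>x\<in>P \<times> Q. \<forall>y\<in>P \<times> Q. x \<noteq> y \<longrightarrow> f t x \<noteq> f t y"
  proof (intro eventually_ball_finite ballI)
    fix x y assume "x \<in> P \<times> Q" "y \<in> P \<times> Q"
    obtain p q p' q' where [simp]: "x = (p, q)" "y = (p', q')" by fastforce
    show "\<forall>\<^sub>F t in at_right 0. x \<noteq> y \<longrightarrow> f t x \<noteq> f t y"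
    proof (cases "p = p'")
      case True
      then show ?thesis
        by (intro eventually_mono[OF eventually_at_right_less[of 0]]) (auto simp: f_def)
    next
      case False
      have "((\<lambda>t. (p + t *\<^sub>R q) - (p' + t *\<^sub>R q')) \<longlongrightarrow> (p + 0 *\<^sub>R q) - (p' + 0 *\<^sub>R q')) (at_right 0)"
        by (intro tendsto_intros)
      then have "\<forall>\<^sub>F t in at_right 0. (p + t *\<^sub>R q) - (p' + t *\<^sub>R q') \<noteq> 0"
        by (rule tendsto_imp_eventually_ne) (use False in simp)
      then show ?thesis by (rule eventually_mono) (simp add: f_def)
    qed
  qed (use P Q in auto)
  moreover have "\<forall>\<^sub>F t in at_right 0. t > (0::real)" by (rule eventually_at_right_less)
  ultimately have ev: "\<forall>\<^sub>F t in at_right 0. t > 0 \<and> inj_on (f t) (P \<times> Q) \<and>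
      (\<forall>S\<in>F. \<forall>g\<in>S \<rightarrow>\<^sub>E Q. eps_similar \<epsilon> ((\<lambda>p. p + t *\<^sub>R g p) ` S) T)"
    unfolding inj_on_def by eventually_elim blast
  obtain t :: real where t: "t > 0" "inj_on (f t) (P \<times> Q)"
      "\<forall>S\<in>F. \<forall>g\<in>S \<rightarrow>\<^sub>E Q. eps_similar \<epsilon> ((\<lambda>p. p + t *\<^sub>R g p) ` S) T"
    using eventually_happens'[OF trivial_limit_at_right_real ev] by (elim exE conjE) (rule that)
  define R where "R = f t ` (P \<times> Q)"
  have R: "finite R" "card R = n * m"
    using P Q t(2) by (auto simp: R_def card_image card_cartesian_product)
  define H where "H = {X. X \<subseteq> P \<times> Q \<and> eps_similar \<epsilon> (f t ` X) T}"
  have "card F * card Q ^ 3 + card P * card G \<le> card H"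
  proof (rule card_blow_up_triples[OF P(1) Q(1)])
    show "(\<lambda>p. (p, g p)) ` S \<in> H" if "S \<in> F" "g \<in> S \<rightarrow>\<^sub>E Q" for S g
      using that t(3)[THEN bspec, THEN bspec, OF that] by (auto simp: H_def F_def f_def image_image)
    show "Pair p ` S \<in> H" if "p \<in> P" "S \<in> G" for p S
      using that eps_similar_homothety[of \<epsilon> S T t p] t(1)
      by (auto simp: H_def G_def f_def image_image)
  qed (auto simp: F_def G_def H_def eps_similar_def is_triangle_def)
  also have "card H \<le> similar_count R T \<epsilon>"
    unfolding similar_count_def
  proof (rule card_inj_on_le)
    show "inj_on ((`) (f t)) H"
      by (rule inj_onI) (simp add: H_def inj_on_image_eq_iff[OF t(2)])
    show "(`) (f t) ` H \<subseteq> {S. S \<subseteq> R \<and> eps_similar \<epsilon> S T}" by (auto simp: H_def R_def)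
    show "finite {S. S \<subseteq> R \<and> eps_similar \<epsilon> S T}"
      by (rule finite_subset[of _ "Pow R"]) (use R in auto)
  qed
  also have "\<dots> \<le> h (n * m) T \<epsilon>" using similar_count_le_h[OF R(1)] R(2) by metis
  finally show ?thesis using P Q by (simp add: F_def G_def similar_count_def)
qed

section \<open>The limit density\<close>

text \<open>The limit is that of the nonincreasing sequence of densities, so it is a lower bound for each
  of them. The denominator vanishes for \<open>n < 3\<close>, whence the shift by \<open>3\<close> in the proof.\<close>

lemma h_density_limit:
  obtains L where "(\<lambda>n. real (h n T \<epsilon>) / real n ^ 3) \<longlonglongrightarrow> L"
    and "\<And>n. L * (real n * (real n - 1) * (real n - 2)) \<le> real (h n T \<epsilon>)"
proof -
  define D where "D = (\<lambda>n. real n * (real n - 1) * (real n - 2))"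
  define b where "b = (\<lambda>n. real (h n T \<epsilon>) / D n)"
  have Dpos: "D n > 0" if "n \<ge> 3" for n using that by (simp add: D_def)
  have step: "b (Suc n) \<le> b n" if "n \<ge> 3" for n
  proof -
    have "real ((n - 2) * h (Suc n) T \<epsilon>) \<le> real (Suc n * h n T \<epsilon>)"
      using h_averaging of_nat_le_iff by blast
    then have le: "(real n - 2) * real (h (Suc n) T \<epsilon>) \<le> (real n + 1) * real (h n T \<epsilon>)"
      using that by (simp add: of_nat_diff algebra_simps)
    have "real (h (Suc n) T \<epsilon>) * D n
        = (real n * (real n - 1)) * ((real n - 2) * real (h (Suc n) T \<epsilon>))"
      by (simp add: D_def)
    also have "\<dots> \<le> (real n * (real n - 1)) * ((real n + 1) * real (h n T \<epsilon>))"
      using that by (intro mult_left_mono le) auto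
    also have "\<dots> = real (h n T \<epsilon>) * D (Suc n)" by (simp add: D_def algebra_simps)
    finally show ?thesis
      using Dpos[of n] Dpos[of "Suc n"] that by (simp add: b_def divide_simps)
  qed
  have "b (Suc n + 3) \<le> b (n + 3)" for n using step[of "n + 3"] by simp
  then have "decseq (\<lambda>n. b (n + 3))" by (rule decseq_SucI)
  moreover have "\<forall>n. 0 \<le> b (n + 3)"
    using Dpos by (simp add: b_def less_imp_le)
  ultimately obtain L where L: "(\<lambda>n. b (n + 3)) \<longlonglongrightarrow> L" and L_le: "\<forall>n. L \<le> b (n + 3)"
    by (rule decseq_convergent)
  have "(\<lambda>n. D n / real n ^ 3) \<longlonglongrightarrow> 1"
    unfolding D_def by real_asymp
  with LIMSEQ_offset[OF L] have "(\<lambda>n. b n * (D n / real n ^ 3)) \<longlonglongrightarrow> L * 1"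
    by (rule tendsto_mult)
  moreover have "\<forall>\<^sub>F n in sequentially. b n * (D n / real n ^ 3) = real (h n T \<epsilon>) / real n ^ 3"
    using eventually_ge_at_top[of 3] by eventually_elim (use Dpos in \<open>force simp: b_def\<close>)
  ultimately have "(\<lambda>n. real (h n T \<epsilon>) / real n ^ 3) \<longlonglongrightarrow> L"
    unfolding mult_1_right by (rule Lim_transform_eventually)
  moreover have "L * (real n * (real n - 1) * (real n - 2)) \<le> real (h n T \<epsilon>)" for n
  proof (cases "n < 3")
    case True
    then have "n = 0 \<or> n = 1 \<or> n = 2" by auto
    then show ?thesis by auto
  next
    case False
    then have "L * D n \<le> real (h n T \<epsilon>)"
      using L_le[THEN spec, of "n - 3"] Dpos[of n] by (simp add: b_def pos_le_divide_eq)
    then show ?thesis by (simp add: D_def)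
  qed
  ultimately show ?thesis by (rule that)
qed

text \<open>In the blow-up with \<open>m\<close>-point copies, the triangles with vertices in three different copies
  alone would only give \<open>h n \<le> L * n ^ 3\<close>. The triangles inside the \<open>n\<close> copies contribute
  \<open>n * h m\<close>, which is about \<open>L * n * m ^ 3\<close>, and account for the term \<open>- real n\<close>.\<close>

lemma h_le_density_limit:
  assumes lim: "(\<lambda>n. real (h n T \<epsilon>) / real n ^ 3) \<longlonglongrightarrow> L"
  shows "real (h n T \<epsilon>) \<le> L * (real n ^ 3 - real n)"
proof (cases "n = 0")
  case True
  then show ?thesis by (simp add: h_eq_0)
next
  case False
  define a where "a = (\<lambda>n. real (h n T \<epsilon>) / real n ^ 3)"
  have "strict_mono (\<lambda>m. n * m)" using False by (auto simp: strict_mono_def)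
  from LIMSEQ_subseq_LIMSEQ[OF lim this] have "(\<lambda>m. a (n * m)) \<longlonglongrightarrow> L" by (simp add: a_def o_def)
  moreover have "(\<lambda>m. a n + a m / real n ^ 2) \<longlonglongrightarrow> a n + L / real n ^ 2"
    using lim[folded a_def] False by (intro tendsto_intros) auto
  moreover have "\<forall>\<^sub>F m in sequentially. a n + a m / real n ^ 2 \<le> a (n * m)"
    using eventually_gt_at_top[of 0]
  proof eventually_elim
    case (elim m)
    have "real (h n T \<epsilon> * m ^ 3 + n * h m T \<epsilon>) \<le> real (h (n * m) T \<epsilon>)"
      using h_blow_up of_nat_le_iff by blast
    then have "(real (h n T \<epsilon>) * real m ^ 3 + real n * real (h m T \<epsilon>)) / (real n * real m) ^ 3
        \<le> a (n * m)"
      by (simp add: a_def divide_right_mono)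
    moreover have "(real (h n T \<epsilon>) * real m ^ 3 + real n * real (h m T \<epsilon>)) / (real n * real m) ^ 3
        = a n + a m / real n ^ 2"
      using False elim by (simp add: a_def field_simps power2_eq_square power3_eq_cube)
    ultimately show ?case by simp
  qed
  ultimately have "a n + L / real n ^ 2 \<le> L" by (intro tendsto_le[OF sequentially_bot])
  then have "(a n + L / real n ^ 2) * real n ^ 3 \<le> L * real n ^ 3"
    by (intro mult_right_mono) auto
  moreover have "(a n + L / real n ^ 2) * real n ^ 3 = real (h n T \<epsilon>) + L * real n"
    using False by (simp add: a_def field_simps power2_eq_square power3_eq_cube)
  ultimately show ?thesis by (simp add: algebra_simps)
qed

theorem theorem1p3:
  fixes T :: "(real^2) set" and \<epsilon> :: real
  assumes "is_triangle T" and "\<not> collinear T"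
    and "\<epsilon> > 0" and "\<forall>\<theta>\<in>triangle_angles T. \<epsilon> < \<theta>"
  shows "convergent (\<lambda>n. real (h n T \<epsilon>) / real n ^ 3) \<and>
    h_lim T \<epsilon> \<ge> 1 / 24 \<and>
    (\<forall>n::nat. h_lim T \<epsilon> * (real n ^ 3 - real n) \<ge> real (h n T \<epsilon>) \<and>
       real (h n T \<epsilon>) \<ge> h_lim T \<epsilon> * (real n * (real n - 1) * (real n - 2)))"
proof -
  obtain L where lim: "(\<lambda>n. real (h n T \<epsilon>) / real n ^ 3) \<longlonglongrightarrow> L"
    and lower: "\<And>n. L * (real n * (real n - 1) * (real n - 2)) \<le> real (h n T \<epsilon>)"
    using h_density_limit[of T \<epsilon>] by blast
  have upper: "real (h n T \<epsilon>) \<le> L * (real n ^ 3 - real n)" for n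
    by (rule h_le_density_limit[OF lim])
  have "h_lim T \<epsilon> = L" unfolding h_lim_def by (rule limI[OF lim])
  moreover have "L \<ge> 1 / 24" using upper[of 3] h_3_ge_1[OF assms(1,3)] by simp
  moreover have "convergent (\<lambda>n. real (h n T \<epsilon>) / real n ^ 3)" using lim by (rule convergentI)
  ultimately show ?thesis using lower upper by blast
qed

end
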